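(* Let $q=2mn+1$ be a prime power, where $m,n$ are odd and coprime positive integers. Let $\xi\in\mathbb{F}_q^*$ have order $n$, $\epsilon\in\mathbb{F}_q^*$ have order $m$, let $A_{m,n}=(a_{i,j})$ be the $m\times n$ array with $a_{i,j}=\epsilon^{i-1}\xi^{j-1}$, and let $\Pi_{m,n}$ be the Archdeacon embedding of $K_q$ induced by $A_{m,n}$ with the natural orderings $\omega_r$ (rows left to right) and $\omega_c$ (columns top to bottom). Then the group $\mathrm{Aut}_0(\Pi_{m,n})$ of automorphisms of $\Pi_{m,n}$ fixing $0$ is isomorphic to $\mathbb{Z}_{mn}$, the full automorphism group satisfies $|\mathrm{Aut}(\Pi_{m,n})|=\binom{2mn+1}{2}$, and the faces of $\Pi_{m,n}$ are simple cycles of length $m$ and $n$.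
   Context: $A_{m,n}$ is a Heffter array over the additive group of $\mathbb{F}_q$ (every row and column sums to $0$, and $\{\pm x\}$ over entries $x$ covers $\mathbb{F}_q\setminus\{0\}$ exactly once), and the natural orderings are compatible. Here $\omega_r(a_{i,j})=a_{i,j+1}$, $\omega_c(a_{i,j})=a_{i+1,j}$ (indices modulo $n$ and $m$ respectively); writing $\mathcal{E}(A)$ for the set of entries, $\rho_0$ is the permutation of $\mathbb{F}_q\setminus\{0\}$ with $\rho_0(a)=-\omega_r(a)$ for $a\in\mathcal{E}(A)$ and $\rho_0(a)=\omega_c(-a)$ for $a\in-\mathcal{E}(A)$, and $\Pi_{m,n}=(K_q,\rho)$ where $K_q$ has vertex set $\mathbb{F}_q$ and $\rho((x,x+a))=(x,x+\rho_0(a))$ on oriented edges. Faces are the boundary walks given by the orbits of $(x,y)\mapsto(y,\rho_y(x))$ on oriented edges, where $\rho(y,z)=(y,\rho_y(z))$. An automorphism of $\Pi_{m,n}$ is a graph automorphism $\sigma$ of $K_q$ with either $\sigma\circ\rho=\rho\circ\sigma$ or $\sigma\circ\rho=\rho^{-1}\circ\sigma$ on all oriented edges; $\mathrm{Aut}(\Pi_{m,n})$ is the group of all such automorphisms. *)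

theory Defs
  imports "HOL-Algebra.Elementary_Groups" "HOL-Combinatorics.Orbits" "HOL-Number_Theory.Number_Theory"
    "HOL-Number_Theory.Prime_Powers" "HOL-Library.Cardinality"
begin

definition has_mult_order :: "'a::field \<Rightarrow> nat \<Rightarrow> bool" where
  "has_mult_order x k \<longleftrightarrow> 0 < k \<and> x ^ k = 1 \<and> (\<forall>l. 0 < l \<and> l < k \<longrightarrow> x ^ l \<noteq> 1)"

text \<open>An $m \times n$ array is a function of a row index in \<open>{1..m}\<close> and a column index in \<open>{1..n}\<close>;
  the cyclic successor of \<open>j\<close> in \<open>{1..n}\<close> is \<open>j mod n + 1\<close>.\<close>

definition power_array :: "'a::field \<Rightarrow> 'a \<Rightarrow> nat \<Rightarrow> nat \<Rightarrow> 'a" where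
  "power_array \<epsilon> \<xi> i j = \<epsilon> ^ (i - 1) * \<xi> ^ (j - 1)"

definition entries :: "nat \<Rightarrow> nat \<Rightarrow> (nat \<Rightarrow> nat \<Rightarrow> 'a) \<Rightarrow> 'a set" where
  "entries m n A = {A i j | i j. i \<in> {1..m} \<and> j \<in> {1..n}}"

definition heffter_array :: "nat \<Rightarrow> nat \<Rightarrow> (nat \<Rightarrow> nat \<Rightarrow> 'a::ab_group_add) \<Rightarrow> bool" where
  "heffter_array m n A \<longleftrightarrow>
     (\<forall>i\<in>{1..m}. (\<Sum>j=1..n. A i j) = 0) \<and>
     (\<forall>j\<in>{1..n}. (\<Sum>i=1..m. A i j) = 0) \<and>
     bij_betw (\<lambda>(i, j, s). if s then A i j else - A i j)
       ({1..m} \<times> {1..n} \<times> (UNIV :: bool set)) (UNIV - {0})"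

text \<open>The natural orderings are only meaningful on the entries of an array with pairwise distinct
  entries, such as a Heffter array.\<close>

definition omega_r :: "nat \<Rightarrow> nat \<Rightarrow> (nat \<Rightarrow> nat \<Rightarrow> 'a) \<Rightarrow> 'a \<Rightarrow> 'a" where
  "omega_r m n A x =
     (THE y. \<exists>i\<in>{1..m}. \<exists>j\<in>{1..n}. x = A i j \<and> y = A i (j mod n + 1))"

definition omega_c :: "nat \<Rightarrow> nat \<Rightarrow> (nat \<Rightarrow> nat \<Rightarrow> 'a) \<Rightarrow> 'a \<Rightarrow> 'a" where
  "omega_c m n A x =
     (THE y. \<exists>i\<in>{1..m}. \<exists>j\<in>{1..n}. x = A i j \<and> y = A (i mod m + 1) j)"

definition compatible_orderings :: "nat \<Rightarrow> nat \<Rightarrow> (nat \<Rightarrow> nat \<Rightarrow> 'a) \<Rightarrow> bool" where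
  "compatible_orderings m n A \<longleftrightarrow>
     cyclic_on (omega_c m n A \<circ> omega_r m n A) (entries m n A)"

text \<open>For a Heffter array the last case is reached only for \<open>a = 0\<close>.\<close>

definition rho0 :: "nat \<Rightarrow> nat \<Rightarrow> (nat \<Rightarrow> nat \<Rightarrow> 'a::ab_group_add) \<Rightarrow> 'a \<Rightarrow> 'a" where
  "rho0 m n A a =
     (if a \<in> entries m n A then - omega_r m n A a
      else if a \<in> uminus ` entries m n A then omega_c m n A (- a)
      else a)"

text \<open>A graph on all of \<open>'a\<close> is given by its set of oriented edges.\<close>

definition complete_graph :: "('a \<times> 'a) set" where
  "complete_graph = {(x, y). x \<noteq> y}"

definition archdeacon_rotation ::
    "nat \<Rightarrow> nat \<Rightarrow> (nat \<Rightarrow> nat \<Rightarrow> 'a::ab_group_add) \<Rightarrow> 'a \<times> 'a \<Rightarrow> 'a \<times> 'a" where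
  "archdeacon_rotation m n A = (\<lambda>(x, y). (x, x + rho0 m n A (y - x)))"

definition graph_automorphism :: "('a \<times> 'a) set \<Rightarrow> ('a \<Rightarrow> 'a) \<Rightarrow> bool" where
  "graph_automorphism D \<sigma> \<longleftrightarrow>
     bij \<sigma> \<and> (\<forall>x y. (x, y) \<in> D \<longleftrightarrow> (\<sigma> x, \<sigma> y) \<in> D)"

definition embedding_automorphism ::
    "('a \<times> 'a) set \<Rightarrow> ('a \<times> 'a \<Rightarrow> 'a \<times> 'a) \<Rightarrow> ('a \<Rightarrow> 'a) \<Rightarrow> bool" where
  "embedding_automorphism D \<rho> \<sigma> \<longleftrightarrow>
     graph_automorphism D \<sigma> \<and>
     ((\<forall>e\<in>D. map_prod \<sigma> \<sigma> (\<rho> e) = \<rho> (map_prod \<sigma> \<sigma> e)) \<or>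
      (\<forall>e\<in>D. map_prod \<sigma> \<sigma> (\<rho> e) = inv_into D \<rho> (map_prod \<sigma> \<sigma> e)))"

definition Aut_embedding ::
    "('a \<times> 'a) set \<Rightarrow> ('a \<times> 'a \<Rightarrow> 'a \<times> 'a) \<Rightarrow> ('a \<Rightarrow> 'a) monoid" where
  "Aut_embedding D \<rho> =
     \<lparr>carrier = {\<sigma>. embedding_automorphism D \<rho> \<sigma>}, monoid.mult = (\<circ>), one = id\<rparr>"

definition Aut0_embedding ::
    "('a::zero \<times> 'a) set \<Rightarrow> ('a \<times> 'a \<Rightarrow> 'a \<times> 'a) \<Rightarrow> ('a \<Rightarrow> 'a) monoid" where
  "Aut0_embedding D \<rho> =
     (Aut_embedding D \<rho>)\<lparr>carrier := {\<sigma> \<in> carrier (Aut_embedding D \<rho>). \<sigma> 0 = 0}\<rparr>"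

definition face_map :: "('a \<times> 'a \<Rightarrow> 'a \<times> 'a) \<Rightarrow> 'a \<times> 'a \<Rightarrow> 'a \<times> 'a" where
  "face_map \<rho> = (\<lambda>(x, y). (y, snd (\<rho> (y, x))))"

text \<open>The boundary walk of the face through the oriented edge \<open>e\<close>, as the list of the initial
  vertices of the oriented edges met during one traversal of the orbit of \<open>e\<close>.\<close>

definition face_walk :: "('a \<times> 'a \<Rightarrow> 'a \<times> 'a) \<Rightarrow> 'a \<times> 'a \<Rightarrow> 'a list" where
  "face_walk \<rho> e =
     map (\<lambda>k. fst ((face_map \<rho> ^^ k) e)) [0..<card (orbit (face_map \<rho>) e)]"

definition face_walks :: "('a \<times> 'a) set \<Rightarrow> ('a \<times> 'a \<Rightarrow> 'a \<times> 'a) \<Rightarrow> 'a list set" where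
  "face_walks D \<rho> = face_walk \<rho> ` D"

definition simple_cycle :: "('a \<times> 'a) set \<Rightarrow> 'a list \<Rightarrow> bool" where
  "simple_cycle D w \<longleftrightarrow>
     3 \<le> length w \<and> distinct w \<and>
     (\<forall>k<length w. (w ! k, w ! (Suc k mod length w)) \<in> D)"

text \<open>The array of the theorem is a Heffter array as soon as \<open>m, n > 1\<close> (for \<open>m = 1\<close> or
  \<open>n = 1\<close> the zero-sum condition fails), and its natural orderings are compatible.\<close>

lemma has_mult_order_mod:
  assumes "has_mult_order x k"
  shows "x ^ a = x ^ (a mod k)"
proof -
  have "x ^ a = x ^ (k * (a div k) + a mod k)" by simp
  also have "\<dots> = (x ^ k) ^ (a div k) * x ^ (a mod k)" by (simp only: power_add power_mult)
  finally show ?thesis using assms by (simp add: has_mult_order_def)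
qed

lemma has_mult_order_nonzero: "has_mult_order x k \<Longrightarrow> x \<noteq> 0"
  by (auto simp: has_mult_order_def power_0_left split: if_splits)

lemma has_mult_order_eq_iff:
  assumes "has_mult_order x k"
  shows "x ^ a = x ^ b \<longleftrightarrow> [a = b] (mod k)"
proof
  have k: "0 < k" using assms by (simp add: has_mult_order_def)
  have *: "\<not> s < t" if "x ^ s = x ^ t" "t < k" for s t
  proof
    assume "s < t"
    have "x ^ t = x ^ s * x ^ (t - s)"
      unfolding power_add[symmetric] using \<open>s < t\<close> by simp
    then have "x ^ s * x ^ (t - s) = x ^ s * 1"
      using that(1) by (metis mult.right_neutral)
    then have "x ^ (t - s) = 1"
      using has_mult_order_nonzero[OF assms] by simp
    then show False using assms that \<open>s < t\<close> by (simp add: has_mult_order_def)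
  qed
  assume "x ^ a = x ^ b"
  then have "x ^ (a mod k) = x ^ (b mod k)"
    using has_mult_order_mod[OF assms] by metis
  then show "[a = b] (mod k)"
    unfolding cong_def using *[of "a mod k" "b mod k"] *[of "b mod k" "a mod k"] k
    by (metis linorder_neqE_nat mod_less_divisor)
next
  assume "[a = b] (mod k)"
  then show "x ^ a = x ^ b" using has_mult_order_mod[OF assms] by (metis cong_def)
qed

lemma mixed_powers_eq:
  assumes "has_mult_order \<epsilon> m" "has_mult_order \<xi> n" "coprime m n"
    and "\<epsilon> ^ i * \<xi> ^ j = \<epsilon> ^ k * \<xi> ^ l"
  shows "[i = k] (mod m)"
proof -
  have "(\<epsilon> ^ i * \<xi> ^ j) ^ n = \<epsilon> ^ (i * n) * (\<xi> ^ n) ^ j" for i j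
    by (simp add: power_mult_distrib mult.commute flip: power_mult)
  then have "\<epsilon> ^ (i * n) = \<epsilon> ^ (k * n)"
    using assms by (metis has_mult_order_def mult.right_neutral power_one)
  then have "[i * n = k * n] (mod m)" using has_mult_order_eq_iff[OF assms(1)] by simp
  then show ?thesis using assms(3) by (metis cong_mult_rcancel_nat coprime_commute)
qed

lemma power_array_inj:
  assumes "has_mult_order \<epsilon> m" "has_mult_order \<xi> n" "coprime m n"
    and "i \<in> {1..m}" "k \<in> {1..m}" "j \<in> {1..n}" "l \<in> {1..n}"
    and "power_array \<epsilon> \<xi> i j = power_array \<epsilon> \<xi> k l"
  shows "i = k \<and> j = l"
proof -
  have "[i - 1 = k - 1] (mod m)"
    using mixed_powers_eq[OF assms(1-3)] assms(8) by (simp add: power_array_def)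
  then have 1: "i - 1 = k - 1" using assms by (auto intro: cong_less_modulus_unique_nat)
  have "[j - 1 = l - 1] (mod n)"
    using mixed_powers_eq[OF assms(2,1)] assms(3,8)
    by (metis coprime_commute mult.commute power_array_def)
  then have 2: "j - 1 = l - 1" using assms by (auto intro: cong_less_modulus_unique_nat)
  show ?thesis using 1 2 assms by auto
qed

lemma odd_card_field_neg1:
  assumes "odd CARD('a::{field,finite})"
  shows "(- 1 :: 'a) \<noteq> 1"
proof
  assume eq: "(- 1 :: 'a) = 1"
  have "(\<Sum>y\<in>UNIV. y + (1::'a)) = (\<Sum>y\<in>UNIV. y)"
    by (rule sum.reindex_bij_witness[of _ "\<lambda>y. y - 1" "\<lambda>y. y + 1"]) auto
  then have 0: "of_nat (CARD('a)) = (0::'a)" by (simp add: sum.distrib)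
  obtain k where "CARD('a) = 2 * k + 1" using assms oddE by blast
  moreover have "(2::'a) = 0" using eq by (metis add.right_inverse one_add_one)
  ultimately show False using 0 by simp
qed

lemma sum_powers_zero:
  assumes "has_mult_order x k" "1 < k"
  shows "(\<Sum>j=1..k. x ^ (j - 1)) = 0"
proof -
  have "x \<noteq> 1" using assms by (metis has_mult_order_def less_numeral_extra(1) power_one_right)
  moreover have "(\<Sum>j=1..k. x ^ (j - 1)) = (\<Sum>j<k. x ^ j)"
    by (rule sum.reindex_bij_witness[of _ Suc "\<lambda>j. j - 1"]) auto
  ultimately show ?thesis using assms by (simp add: geometric_sum has_mult_order_def)
qed

lemma power_array_heffter:
  fixes \<epsilon> \<xi> :: "'a::{field,finite}"
  assumes "CARD('a) = 2 * m * n + 1" "odd m" "odd n" "coprime m n" "1 < m" "1 < n"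
    and \<xi>: "has_mult_order \<xi> n" and \<epsilon>: "has_mult_order \<epsilon> m"
  shows "heffter_array m n (power_array \<epsilon> \<xi>)"
  unfolding heffter_array_def
proof (intro conjI ballI)
  fix i show "(\<Sum>j=1..n. power_array \<epsilon> \<xi> i j) = 0"
    unfolding power_array_def sum_distrib_left[symmetric]
    using sum_powers_zero[OF \<xi> \<open>1 < n\<close>] by simp
next
  fix j show "(\<Sum>i=1..m. power_array \<epsilon> \<xi> i j) = 0"
    unfolding power_array_def sum_distrib_right[symmetric]
    using sum_powers_zero[OF \<epsilon> \<open>1 < m\<close>] by simp
next
  let ?A = "power_array \<epsilon> \<xi>"
  let ?f = "\<lambda>(i, j, s). if s then ?A i j else - ?A i j"
  let ?S = "{1..m} \<times> {1..n} \<times> (UNIV :: bool set)"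
  have neg: "(- 1 :: 'a) \<noteq> 1" by (rule odd_card_field_neg1) (simp add: assms(1))
  have one: "?A i j ^ (m * n) = 1" for i j
  proof -
    have "?A i j ^ (m * n) = (\<epsilon> ^ m) ^ ((i - 1) * n) * (\<xi> ^ n) ^ ((j - 1) * m)"
      by (simp add: power_array_def power_mult_distrib ac_simps flip: power_mult)
    then show ?thesis using \<xi> \<epsilon> by (simp add: has_mult_order_def)
  qed
  have sgn: "?A i j \<noteq> - ?A k l" for i j k l
  proof
    assume "?A i j = - ?A k l"
    then have "?A i j ^ (m * n) = - (?A k l ^ (m * n))"
      using \<open>odd m\<close> \<open>odd n\<close> by simp
    then show False using one neg by simp
  qed
  have inj: "inj_on ?f ?S"
  proof (rule inj_onI)
    fix x y assume xy: "x \<in> ?S" "y \<in> ?S" "?f x = ?f y"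
    obtain i j s k l t where eq: "x = (i, j, s)" "y = (k, l, t)" by (cases x, cases y)
    have h: "i \<in> {1..m}" "j \<in> {1..n}" "k \<in> {1..m}" "l \<in> {1..n}"
      and e: "(if s then ?A i j else - ?A i j) = (if t then ?A k l else - ?A k l)"
      using xy unfolding eq by simp_all
    have st: "s = t" using e sgn[of i j k l] sgn[of k l i j] by (cases s; cases t) simp_all
    then have "?A i j = ?A k l" using e by (cases t) simp_all
    then show "x = y"
      using power_array_inj[OF \<epsilon> \<xi> \<open>coprime m n\<close> h(1,3,2,4)] st eq by simp
  qed
  have sub: "?f ` ?S \<subseteq> UNIV - {0}"
    using has_mult_order_nonzero[OF \<xi>] has_mult_order_nonzero[OF \<epsilon>]
    by (auto simp: power_array_def split: if_splits)
  have "card (?f ` ?S) = 2 * m * n" using card_image[OF inj] by (simp add: card_cartesian_product)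
  moreover have "card (UNIV - {0::'a}) = 2 * m * n" using assms(1) by (simp add: card_Diff_subset)
  ultimately have "?f ` ?S = UNIV - {0}" using sub by (intro card_subset_eq) auto
  then show "bij_betw ?f ?S (UNIV - {0})" using inj by (simp add: bij_betw_def)
qed

lemma omega_power_array:
  assumes \<xi>: "has_mult_order \<xi> n" and \<epsilon>: "has_mult_order \<epsilon> m" and "coprime m n"
    and x: "x \<in> entries m n (power_array \<epsilon> \<xi>)"
  shows "omega_r m n (power_array \<epsilon> \<xi>) x = \<xi> * x"
    and "omega_c m n (power_array \<epsilon> \<xi>) x = \<epsilon> * x"
proof -
  have cyc: "y ^ (j mod k) = y * y ^ (j - 1)" if "has_mult_order y k" "j \<in> {1..k}" for y :: 'a and j k
    using that has_mult_order_mod[OF that(1), of j] by (simp flip: power_Suc)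
  obtain i j where ij: "i \<in> {1..m}" "j \<in> {1..n}" "x = power_array \<epsilon> \<xi> i j"
    using x by (auto simp: entries_def)
  have u: "i' = i \<and> j' = j"
    if "i' \<in> {1..m}" "j' \<in> {1..n}" "x = power_array \<epsilon> \<xi> i' j'" for i' j'
    using power_array_inj[OF \<epsilon> \<xi> \<open>coprime m n\<close> that(1) ij(1) that(2) ij(2)] that(3) ij(3) by simp
  have "omega_r m n (power_array \<epsilon> \<xi>) x = power_array \<epsilon> \<xi> i (j mod n + 1)"
    unfolding omega_r_def by (rule the_equality) (use ij u in blast)+
  then show "omega_r m n (power_array \<epsilon> \<xi>) x = \<xi> * x"
    using cyc[OF \<xi> ij(2)] ij by (simp add: power_array_def)
  have "omega_c m n (power_array \<epsilon> \<xi>) x = power_array \<epsilon> \<xi> (i mod m + 1) j"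
    unfolding omega_c_def by (rule the_equality) (use ij u in blast)+
  then show "omega_c m n (power_array \<epsilon> \<xi>) x = \<epsilon> * x"
    using cyc[OF \<epsilon> ij(1)] ij by (simp add: power_array_def)
qed

lemma entries_power_array:
  assumes \<xi>: "has_mult_order \<xi> n" and \<epsilon>: "has_mult_order \<epsilon> m"
  shows "entries m n (power_array \<epsilon> \<xi>) = {\<epsilon> ^ a * \<xi> ^ b | a b. True}"
proof (intro equalityI subsetI)
  fix x assume "x \<in> {\<epsilon> ^ a * \<xi> ^ b | a b. True}"
  then obtain a b where "x = \<epsilon> ^ a * \<xi> ^ b" by blast
  then have "x = power_array \<epsilon> \<xi> (a mod m + 1) (b mod n + 1)"
    using has_mult_order_mod[OF \<xi>, of b] has_mult_order_mod[OF \<epsilon>, of a]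
    by (simp add: power_array_def)
  moreover have "a mod m + 1 \<in> {1..m}" "b mod n + 1 \<in> {1..n}"
    using \<xi> \<epsilon> by (auto simp: has_mult_order_def Suc_le_eq)
  ultimately show "x \<in> entries m n (power_array \<epsilon> \<xi>)" by (auto simp: entries_def)
qed (auto simp: entries_def power_array_def)

lemma power_array_compatible:
  assumes \<xi>: "has_mult_order \<xi> n" and \<epsilon>: "has_mult_order \<epsilon> m" and co: "coprime m n"
  shows "compatible_orderings m n (power_array \<epsilon> \<xi>)"
proof -
  let ?E = "entries m n (power_array \<epsilon> \<xi>)"
  let ?w = "omega_c m n (power_array \<epsilon> \<xi>) \<circ> omega_r m n (power_array \<epsilon> \<xi>)"
  note E = entries_power_array[OF \<xi> \<epsilon>]
  have mem: "\<epsilon> ^ a * \<xi> ^ b \<in> ?E" for a b unfolding E by blast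
  have w: "(?w ^^ k) 1 = \<epsilon> ^ k * \<xi> ^ k" for k
  proof (induction k)
    case (Suc k)
    have "omega_r m n (power_array \<epsilon> \<xi>) (\<epsilon> ^ k * \<xi> ^ k) = \<epsilon> ^ k * \<xi> ^ Suc k"
      using omega_power_array(1)[OF \<xi> \<epsilon> co mem] by (simp add: ac_simps)
    moreover have "omega_c m n (power_array \<epsilon> \<xi>) (\<epsilon> ^ k * \<xi> ^ Suc k) = \<epsilon> ^ Suc k * \<xi> ^ Suc k"
      unfolding omega_power_array(2)[OF \<xi> \<epsilon> co mem] by (simp add: ac_simps)
    ultimately show ?case using Suc by simp
  qed simp
  have "?E = orbit ?w 1"
  proof (intro equalityI subsetI)
    fix x assume "x \<in> ?E"
    then obtain a b where x: "x = \<epsilon> ^ a * \<xi> ^ b" unfolding E by blast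
    obtain k where k: "[k = a] (mod m)" "[k = b] (mod n)"
      using binary_chinese_remainder_nat[OF co] by blast
    let ?k = "k + m * n"
    have "[?k = a] (mod m)" "[?k = b] (mod n)" using k by (simp_all add: cong_def)
    then have "\<epsilon> ^ ?k = \<epsilon> ^ a" "\<xi> ^ ?k = \<xi> ^ b"
      by (simp_all only: has_mult_order_eq_iff[OF \<xi>] has_mult_order_eq_iff[OF \<epsilon>])
    then have "x = (?w ^^ ?k) 1" by (simp only: w x)
    moreover have "0 < ?k" using \<xi> \<epsilon> by (simp add: has_mult_order_def)
    ultimately show "x \<in> orbit ?w 1" unfolding orbit_altdef by blast
  qed (auto simp: orbit_altdef w mem)
  moreover have "1 \<in> ?E" using mem[of 0 0] by simp
  ultimately show ?thesis unfolding compatible_orderings_def cyclic_on_def by blast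
qed

end

theory Submission
  imports Defs
begin

text \<open>The entries form the group \<open>E\<close> generated by \<open>\<epsilon> * \<xi>\<close>, of order \<open>m * n\<close>, and since \<open>m * n\<close>
  is odd the nonzero elements are the disjoint union of \<open>E\<close> and \<open>- E\<close>. On \<open>E\<close> the map \<open>rho0\<close> is
  multiplication by \<open>- \<xi>\<close>, on \<open>- E\<close> by \<open>- \<epsilon>\<close>. Hence the face through an oriented edge of difference
  \<open>d\<close> has length \<open>m\<close> or \<open>n\<close> according to whether \<open>d\<close> lies in \<open>E\<close> or \<open>- E\<close>. As \<open>m \<noteq> n\<close>, an
  automorphism commuting with the rotation preserves the class of every difference, so by the
  rotation at \<open>0\<close> it is \<open>x \<mapsto> g * x + b\<close> with \<open>g \<in> E\<close>. An automorphism inverting the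
  rotation would exchange the two classes, and the rotations at \<open>0\<close>, \<open>1\<close> and \<open>- 1\<close> would then give
  \<open>m = n = 3\<close>.\<close>

section \<open>Multiplicative orders and orbit lengths\<close>

lemma has_mult_order_power_eq_1_iff:
  assumes "has_mult_order x k"
  shows "x ^ l = 1 \<longleftrightarrow> k dvd l"
  using has_mult_order_eq_iff[OF assms, of l 0] by (simp add: cong_0_iff)

text \<open>A relation \<open>(x * y) ^ l = 1\<close> separates, by \<open>mixed_powers_eq\<close>
  used in both orders, into \<open>m dvd l\<close> and \<open>n dvd l\<close>; coprimality
  recombines the two.\<close>

lemma has_mult_order_mult:
  assumes "has_mult_order x m" "has_mult_order y n" "coprime m n"
  shows "has_mult_order (x * y) (m * n)"
proof -
  have pos: "0 < m * n" using assms by (simp add: has_mult_order_def)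
  have "(x * y) ^ (m * n) = (x ^ m) ^ n * (y ^ n) ^ m"
    by (simp add: power_mult_distrib mult.commute flip: power_mult)
  then have one: "(x * y) ^ (m * n) = 1" using assms by (simp add: has_mult_order_def)
  have "m * n dvd l" if "(x * y) ^ l = 1" for l
  proof -
    have e: "x ^ l * y ^ l = x ^ 0 * y ^ 0" using that by (simp add: power_mult_distrib)
    have "m dvd l" using mixed_powers_eq[OF assms e] by (simp add: cong_0_iff)
    moreover have "n dvd l"
      using mixed_powers_eq[OF assms(2,1), of l l 0 0] assms(3) e
      by (simp add: cong_0_iff coprime_commute mult.commute)
    ultimately show ?thesis using assms(3) by (rule divides_mult)
  qed
  then show ?thesis using pos one
    unfolding has_mult_order_def by (auto dest: nat_dvd_not_less)
qed

text \<open>Two equal iterates with indices \<open>i < j < p\<close> would give the return time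
  \<open>p - j + i\<close>, which is positive and below \<open>p\<close>. Hence the first
  \<open>p\<close> iterates are distinct, and they exhaust the orbit.\<close>

lemma card_orbit_period:
  assumes p: "0 < p" and per: "\<And>k. (f ^^ k) x = x \<longleftrightarrow> p dvd k"
  shows "card (orbit f x) = p"
proof -
  have fp: "(f ^^ p) x = x" by (simp add: per)
  have inj: "inj_on (\<lambda>k. (f ^^ k) x) {..<p}"
  proof (rule inj_onI)
    have *: "\<not> i < j" if "j < p" "(f ^^ i) x = (f ^^ j) x" for i j
    proof
      assume "i < j"
      have "(f ^^ (p - j + i)) x = (f ^^ (p - j)) ((f ^^ j) x)"
        using that(2) by (simp only: funpow_add o_apply)
      also have "\<dots> = (f ^^ (p - j + j)) x" by (simp only: funpow_add o_apply)
      also have "\<dots> = x" using that fp by simp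
      finally have "p dvd p - j + i" by (simp only: per)
      then show False using that \<open>i < j\<close> by (auto dest: dvd_imp_le)
    qed
    fix i j assume "i \<in> {..<p}" "j \<in> {..<p}" "(f ^^ i) x = (f ^^ j) x"
    then show "i = j" using *[of i j] *[of j i] by (metis lessThan_iff linorder_neqE_nat)
  qed
  have "orbit f x = (\<lambda>k. (f ^^ k) x) ` {..<p}"
  proof (intro equalityI subsetI)
    fix y assume "y \<in> orbit f x"
    then obtain k where "y = (f ^^ k) x" by (auto simp: orbit_altdef)
    then have "y = (f ^^ (k mod p)) x" by (simp add: funpow_mod_eq fp)
    then show "y \<in> (\<lambda>k. (f ^^ k) x) ` {..<p}" using p by auto
  next
    fix y assume "y \<in> (\<lambda>k. (f ^^ k) x) ` {..<p}"
    then obtain k where k: "y = (f ^^ k) x" by auto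
    \<comment> \<open>\<open>orbit\<close> collects positive iterates, so a full period is added to
      cover \<open>k = 0\<close>.\<close>
    then have "y = (f ^^ (k + p)) x" by (simp add: funpow_add fp)
    then show "y \<in> orbit f x" using p unfolding orbit_altdef by blast
  qed
  then show ?thesis using card_image[OF inj] by simp
qed

section \<open>The group of entries and its negative\<close>

locale power_embedding =
  fixes m n :: nat and \<epsilon> \<xi> :: "'a::{field,finite}"
  assumes card_field: "CARD('a) = 2 * m * n + 1"
    and odd: "odd m" "odd n" and coprime: "coprime m n" and gt1: "1 < m" "1 < n"
    and \<xi>: "has_mult_order \<xi> n" and \<epsilon>: "has_mult_order \<epsilon> m"
begin

abbreviation "A \<equiv> power_array \<epsilon> \<xi>"
abbreviation "E \<equiv> entries m n A"
abbreviation "r \<equiv> rho0 m n A"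
abbreviation "R \<equiv> archdeacon_rotation m n A"
abbreviation "\<gamma> \<equiv> \<epsilon> * \<xi>"

lemma nonzero [simp]: "\<xi> \<noteq> 0" "\<epsilon> \<noteq> 0"
  using \<xi> \<epsilon> by (simp_all add: has_mult_order_nonzero)

lemma \<gamma>: "has_mult_order \<gamma> (m * n)"
  by (rule has_mult_order_mult[OF \<epsilon> \<xi> coprime])

text \<open>The Chinese remainder theorem merges the exponents of \<epsilon> and \<xi> into a single
  one.\<close>

lemma E_eq_powers: "E = range (\<lambda>k. \<gamma> ^ k)"
proof (intro equalityI subsetI)
  fix x assume "x \<in> E"
  then obtain a b where x: "x = \<epsilon> ^ a * \<xi> ^ b" unfolding entries_power_array[OF \<xi> \<epsilon>] by blast
  obtain k where "[k = a] (mod m)" "[k = b] (mod n)"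
    using binary_chinese_remainder_nat[OF coprime] by blast
  then have "\<epsilon> ^ k = \<epsilon> ^ a" "\<xi> ^ k = \<xi> ^ b"
    by (simp_all only: has_mult_order_eq_iff[OF \<xi>] has_mult_order_eq_iff[OF \<epsilon>])
  then show "x \<in> range (\<lambda>k. \<gamma> ^ k)" by (simp add: x power_mult_distrib image_iff) metis
qed (auto simp: entries_power_array[OF \<xi> \<epsilon>] power_mult_distrib)

lemma E_cases:
  assumes "a \<in> E" obtains k where "a = \<gamma> ^ k"
  using assms unfolding E_eq_powers by blast

lemma E_mult: "a \<in> E \<Longrightarrow> b \<in> E \<Longrightarrow> a * b \<in> E"
  unfolding E_eq_powers by (auto simp flip: power_add)

lemma E_gen: "1 \<in> E" "\<epsilon> \<in> E" "\<xi> \<in> E"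
  unfolding entries_power_array[OF \<xi> \<epsilon>]
  by (rule CollectI, rule exI[of _ 0], rule exI[of _ 0], simp,
      rule CollectI, rule exI[of _ 1], rule exI[of _ 0], simp,
      rule CollectI, rule exI[of _ 0], rule exI[of _ 1], simp)

lemma E_power: "a \<in> E \<Longrightarrow> a ^ k \<in> E"
  by (induction k) (auto intro: E_mult E_gen)

lemma E_power_one: assumes "a \<in> E" shows "a ^ (m * n) = 1"
proof -
  obtain k where "a = \<gamma> ^ k" using assms by (rule E_cases)
  then have "a ^ (m * n) = (\<gamma> ^ (m * n)) ^ k" by (simp only: power_mult[symmetric] mult.commute)
  also have "\<gamma> ^ (m * n) = 1" using \<gamma> by (simp only: has_mult_order_def)
  finally show ?thesis by simp
qed

lemma E_inverse: assumes "a \<in> E" shows "inverse a \<in> E"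
proof -
  have "a ^ (m * n - 1) * a = 1"
    using power_minus_mult[of "m * n" a] E_power_one[OF assms] gt1 by simp
  then have "inverse a = a ^ (m * n - 1)" by (metis inverse_unique mult.commute)
  then show ?thesis using E_power[OF assms] by simp
qed

lemma E_divide: "a \<in> E \<Longrightarrow> b \<in> E \<Longrightarrow> a / b \<in> E"
  by (simp add: divide_inverse E_mult E_inverse)

lemma E_nonzero: "a \<in> E \<Longrightarrow> a \<noteq> 0"
  by (auto elim!: E_cases)

lemma E_mult_iff: "b \<in> E \<Longrightarrow> b * a \<in> E \<longleftrightarrow> a \<in> E"
  using E_mult[of b a] E_divide[of "b * a" b] E_nonzero[of b] by auto

lemma minus_one_neq: "(-1::'a) \<noteq> 1"
  by (rule odd_card_field_neg1) (simp add: card_field)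

text \<open>As \<open>m * n\<close> is odd, the power \<open>m * n\<close> sends \<open>- a\<close>
  to \<open>- 1\<close>, whereas it sends every element of \<open>E\<close> to
  \<open>1\<close>.\<close>

lemma E_minus: assumes "a \<in> E" shows "- a \<notin> E"
proof
  assume "- a \<in> E"
  from E_power_one[OF this] have "- (a ^ (m * n)) = 1" using odd by simp
  then show False using E_power_one[OF assms] minus_one_neq by simp
qed

lemma card_E: "card E = m * n"
proof -
  have "inj_on (\<lambda>k. \<gamma> ^ k) {..<m * n}"
    by (rule inj_onI) (auto simp: has_mult_order_eq_iff[OF \<gamma>] intro: cong_less_modulus_unique_nat)
  moreover have "E = (\<lambda>k. \<gamma> ^ k) ` {..<m * n}"
  proof (intro equalityI subsetI)
    fix a assume "a \<in> E"
    then obtain k where "a = \<gamma> ^ (k mod (m * n))"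
      using has_mult_order_mod[OF \<gamma>] by (metis E_cases)
    moreover have "k mod (m * n) < m * n" using gt1 by simp
    ultimately show "a \<in> (\<lambda>k. \<gamma> ^ k) ` {..<m * n}" by blast
  qed (auto simp: E_eq_powers)
  ultimately show ?thesis by (simp add: card_image)
qed

text \<open>Counting: \<open>E\<close> and its negative are disjoint of size \<open>m * n\<close>,
  and there are \<open>2 * m * n\<close> nonzero elements.\<close>

lemma E_total: assumes "a \<noteq> 0" "a \<notin> E" shows "- a \<in> E"
proof -
  have "inj_on uminus E" by (rule inj_onI) simp
  then have "card (uminus ` E) = m * n" by (simp add: card_image card_E)
  moreover have "E \<inter> uminus ` E = {}" using E_minus by auto
  ultimately have "card (E \<union> uminus ` E) = 2 * m * n" by (simp add: card_Un_disjoint card_E)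
  moreover have "card (UNIV - {0::'a}) = 2 * m * n" by (simp add: card_field card_Diff_subset)
  moreover have "E \<union> uminus ` E \<subseteq> UNIV - {0}" using E_nonzero by auto
  ultimately have "E \<union> uminus ` E = UNIV - {0}" by (intro card_subset_eq) auto
  then have "a \<in> uminus ` E" using assms by blast
  then show ?thesis by auto
qed

section \<open>The rotation at 0 on the two classes\<close>

lemma r_pos: "a \<in> E \<Longrightarrow> r a = - (\<xi> * a)"
  by (simp add: rho0_def omega_power_array[OF \<xi> \<epsilon> coprime])

lemma r_neg: "- a \<in> E \<Longrightarrow> r a = - (\<epsilon> * a)"
  using E_minus[of "- a"] omega_power_array[OF \<xi> \<epsilon> coprime, of "- a"]
  by (force simp: rho0_def image_iff)

lemma r_uminus_E: "a \<in> E \<Longrightarrow> r (- a) = \<epsilon> * a"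
  by (simp add: r_neg)

text \<open>Multiplication by \<open>g\<close> preserves both classes, and on each of them
  \<open>r\<close> is multiplication by a constant.\<close>

lemma r_mult: assumes "g \<in> E" shows "r (g * a) = g * r a"
proof (cases "a = 0")
  case True
  then show ?thesis using E_nonzero by (auto simp: rho0_def)
next
  case False
  then consider "a \<in> E" | "- a \<in> E" using E_total by blast
  then show ?thesis
  proof cases
    case 1
    then show ?thesis using E_mult[OF assms 1] by (simp add: r_pos mult.left_commute)
  next
    case 2
    then show ?thesis using E_mult[OF assms 2] by (simp add: r_neg mult.left_commute)
  qed
qed

lemma zero_notin_E: "0 \<notin> E"
  using E_nonzero by blast

lemma r_zero [simp]: "r 0 = 0"
  using zero_notin_E by (auto simp: rho0_def)

lemma r_nonzero: "a \<noteq> 0 \<Longrightarrow> r a \<noteq> 0"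
  using E_total[of a] by (cases "a \<in> E") (simp_all add: r_neg r_pos)

text \<open>\<open>r\<close> exchanges \<open>E\<close> and its negative, so a value in
  \<open>E\<close> can only come from a negated entry, where \<open>r\<close> multiplies by
  \<open>- \<epsilon>\<close>.\<close>

lemma r_inverse_pos: assumes "b \<in> E" shows "r a = b \<longleftrightarrow> a = - (b / \<epsilon>)"
proof
  assume "r a = b"
  then have "a \<noteq> 0" using E_nonzero[OF assms] by auto
  moreover have "a \<notin> E" using \<open>r a = b\<close> E_minus[of "\<xi> * a"] assms by (auto simp: r_pos E_mult E_gen)
  ultimately have "- a \<in> E" by (rule E_total)
  then show "a = - (b / \<epsilon>)" using \<open>r a = b\<close> by (auto simp: r_neg)
qed (simp add: r_uminus_E E_divide E_gen assms)

lemma r_inverse_neg: assumes "- b \<in> E" shows "r a = b \<longleftrightarrow> a = - (b / \<xi>)"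
proof
  assume "r a = b"
  then have "a \<noteq> 0" using E_nonzero[OF assms] by auto
  moreover have "- a \<notin> E" using \<open>r a = b\<close> E_mult[OF E_gen(2), of "- a"] E_minus[OF assms]
    by (auto simp: r_neg)
  ultimately have "a \<in> E" using E_total by blast
  then show "a = - (b / \<xi>)" using \<open>r a = b\<close> by (auto simp: r_pos)
next
  have "- (b / \<xi>) \<in> E" using E_divide[OF assms E_gen(3)] by simp
  then show "a = - (b / \<xi>) \<Longrightarrow> r a = b" by (simp add: r_pos)
qed

text \<open>Surjectivity is what allows \<open>R\<close> to cancel the \<open>inv_into\<close> in
  the definition of an automorphism that inverts the rotation.\<close>

lemma R_surj: assumes "x \<noteq> y" shows "(x, y) \<in> R ` complete_graph"
proof -
  have "\<exists>a. a \<noteq> 0 \<and> r a = y - x"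
  proof (cases "y - x \<in> E")
    case True
    then have "r (- ((y - x) / \<epsilon>)) = y - x" by (simp only: r_inverse_pos)
    then show ?thesis using assms by (intro exI[of _ "- ((y - x) / \<epsilon>)"]) auto
  next
    case False
    then have "- (y - x) \<in> E" using assms by (intro E_total) auto
    then have "r (- ((y - x) / \<xi>)) = y - x" by (simp only: r_inverse_neg)
    then show ?thesis using assms by (intro exI[of _ "- ((y - x) / \<xi>)"]) auto
  qed
  then obtain a where "a \<noteq> 0" "r a = y - x" by blast
  then show ?thesis
    by (intro image_eqI[of _ _ "(x, x + a)"]) (auto simp: archdeacon_rotation_def complete_graph_def)
qed

section \<open>Face traversal and face lengths\<close>

text \<open>Seen from the other end, an edge of difference \<open>d\<close> has difference \<open>- d\<close>, so traversing a
  face multiplies the current difference by \<open>ratio d\<close>, which never changes its class.\<close>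

definition ratio :: "'a \<Rightarrow> 'a" where "ratio d = (if d \<in> E then \<epsilon> else \<xi>)"
definition period :: "'a \<Rightarrow> nat" where "period d = (if d \<in> E then m else n)"

lemma ratio_order: "has_mult_order (ratio d) (period d)"
  by (simp add: ratio_def period_def \<xi> \<epsilon>)

lemma ratio_E: "ratio d \<in> E"
  by (simp add: ratio_def E_gen)

lemma ratio_mult: "g \<in> E \<Longrightarrow> ratio (g * d) = ratio d"
  by (simp add: ratio_def E_mult_iff)

lemma r_uminus: "d \<noteq> 0 \<Longrightarrow> r (- d) = ratio d * d"
  using E_total[of d] by (auto simp: ratio_def r_uminus_E r_pos)

lemma face_map_step:
  "d \<noteq> 0 \<Longrightarrow> face_map R (x, x + d) = (x + d, x + d + ratio d * d)"
  by (simp add: face_map_def archdeacon_rotation_def r_uminus)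

text \<open>Since the ratio stays the same along a face, the successive differences form a geometric
  progression and the vertices are its partial sums.\<close>

lemma face_map_funpow:
  assumes "d \<noteq> 0"
  shows "(face_map R ^^ k) (x, x + d) =
    (x + (\<Sum>i<k. ratio d ^ i) * d, x + (\<Sum>i<k. ratio d ^ i) * d + ratio d ^ k * d)"
proof (induction k)
  case (Suc k)
  have g: "ratio d ^ k \<in> E" by (rule E_power[OF ratio_E])
  then have "ratio d ^ k * d \<noteq> 0" using assms E_nonzero[OF g] by simp
  from face_map_step[OF this, of "x + (\<Sum>i<k. ratio d ^ i) * d"] show ?case
    unfolding funpow.simps o_apply Suc
    by (simp add: ratio_mult[OF g] distrib_right add.assoc mult.assoc)
qed simp

text \<open>Multiplying the geometric sums by \<open>ratio d - 1\<close>, which is nonzero because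
  the period exceeds 1, reduces equality of vertices to equality of powers of the ratio.\<close>

lemma fst_face_map_funpow_eq_iff:
  assumes "d \<noteq> 0"
  shows "fst ((face_map R ^^ k) (x, x + d)) = fst ((face_map R ^^ l) (x, x + d))
    \<longleftrightarrow> [k = l] (mod period d)"
proof -
  let ?t = "ratio d"
  have "period d \<noteq> 1" using gt1 by (simp add: period_def)
  then have "?t - 1 \<noteq> 0" using has_mult_order_power_eq_1_iff[OF ratio_order, of d 1] by auto
  then have "(\<Sum>i<k. ?t ^ i) = (\<Sum>i<l. ?t ^ i) \<longleftrightarrow>
    (?t - 1) * (\<Sum>i<k. ?t ^ i) = (?t - 1) * (\<Sum>i<l. ?t ^ i)" by simp
  also have "\<dots> \<longleftrightarrow> ?t ^ k = ?t ^ l" by (simp only: power_diff_1_eq[symmetric]) simp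
  also have "\<dots> \<longleftrightarrow> [k = l] (mod period d)" by (rule has_mult_order_eq_iff[OF ratio_order])
  finally show ?thesis using assms by (simp add: face_map_funpow)
qed

lemma face_map_funpow_eq_iff:
  assumes "x \<noteq> y"
  shows "(face_map R ^^ k) (x, y) = (x, y) \<longleftrightarrow> period (y - x) dvd k"
proof -
  have d: "y - x \<noteq> 0" using assms by simp
  have "(face_map R ^^ k) (x, x + (y - x)) = (x, x + (y - x)) \<longleftrightarrow> period (y - x) dvd k"
  proof
    assume "(face_map R ^^ k) (x, x + (y - x)) = (x, x + (y - x))"
    then show "period (y - x) dvd k"
      using fst_face_map_funpow_eq_iff[OF d, of k x 0] by (simp add: cong_0_iff)
  next
    assume *: "period (y - x) dvd k"
    then have "fst ((face_map R ^^ k) (x, x + (y - x))) = x"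
      using fst_face_map_funpow_eq_iff[OF d, of k x 0] by (simp add: cong_0_iff)
    moreover have "ratio (y - x) ^ k = 1"
      using * by (simp add: has_mult_order_power_eq_1_iff[OF ratio_order])
    ultimately show "(face_map R ^^ k) (x, x + (y - x)) = (x, x + (y - x))"
      unfolding face_map_funpow[OF d] by simp
  qed
  then show ?thesis by simp
qed

text \<open>Recognises the class of a difference from the face map alone: outside \<open>E\<close>
  the period \<open>n > 1\<close> would divide \<open>m\<close>, against coprimality. This is how
  automorphisms are shown to respect or exchange the classes.\<close>

lemma face_map_m_fixed_imp_E:
  assumes "x \<noteq> y" "(face_map R ^^ m) (x, y) = (x, y)"
  shows "y - x \<in> E"
  using assms coprime gt1 by (auto simp: face_map_funpow_eq_iff period_def split: if_splits)

lemma period_pos: "0 < period d"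
  using gt1 by (simp add: period_def)

lemma length_face_walk: "x \<noteq> y \<Longrightarrow> length (face_walk R (x, y)) = period (y - x)"
  by (simp add: face_walk_def card_orbit_period[OF period_pos face_map_funpow_eq_iff])

lemma face_walk_nth:
  assumes "x \<noteq> y" "k < period (y - x)"
  shows "face_walk R (x, y) ! k = fst ((face_map R ^^ k) (x, y))"
  using assms length_face_walk[OF assms(1)] by (simp add: face_walk_def)

lemma simple_cycle_face_walk:
  assumes "x \<noteq> y"
  shows "simple_cycle complete_graph (face_walk R (x, y))"
proof -
  let ?p = "period (y - x)" and ?w = "face_walk R (x, y)"
  have d: "y - x \<noteq> 0" using assms by simp
  note eq = fst_face_map_funpow_eq_iff[OF d, of _ x, simplified]
  have p: "3 \<le> ?p" using odd gt1 by (auto simp: period_def) presburger+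
  have "distinct ?w"
    unfolding distinct_conv_nth length_face_walk[OF assms]
    by (auto simp: face_walk_nth[OF assms] eq dest: cong_less_modulus_unique_nat)
  \<comment> \<open>Adjacency in the complete graph is distinctness, so only consecutive vertices
    matter, including the pair that closes the walk.\<close>
  moreover have "?w ! k \<noteq> ?w ! (Suc k mod ?p)" if "k < ?p" for k
  proof -
    have "\<not> [k = Suc k mod ?p] (mod ?p)"
      using that p by (auto simp: cong_def mod_Suc)
    then show ?thesis using that p by (simp add: face_walk_nth[OF assms] eq)
  qed
  ultimately show ?thesis using p
    by (simp add: simple_cycle_def length_face_walk[OF assms] complete_graph_def)
qed

text \<open>Both lengths occur: the difference \<open>1\<close> lies in \<open>E\<close> and
  \<open>- 1\<close> does not.\<close>

lemma length_face_walks: "length ` face_walks complete_graph R = {m, n}"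
proof -
  have "length ` face_walks complete_graph R = period ` {d. d \<noteq> 0}"
  proof (intro equalityI subsetI)
    fix l assume "l \<in> period ` {d. d \<noteq> 0}"
    then obtain d where "d \<noteq> 0" "l = period d" by blast
    then have "l = length (face_walk R (0, d))" "(0, d) \<in> complete_graph"
      by (simp_all add: length_face_walk complete_graph_def)
    then show "l \<in> length ` face_walks complete_graph R" unfolding face_walks_def by blast
  qed (auto simp: face_walks_def complete_graph_def length_face_walk)
  also have "\<dots> = {m, n}"
  proof (intro equalityI subsetI)
    have "period 1 = m" "period (- 1) = n"
      using E_gen(1) E_minus[OF E_gen(1)] by (simp_all add: period_def)
    moreover have "(1::'a) \<noteq> 0" "(- 1::'a) \<noteq> 0" by simp_all
    ultimately show "l \<in> period ` {d. d \<noteq> 0}" if "l \<in> {m, n}" for l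
      using that by (metis (mono_tags, lifting) image_eqI insertE mem_Collect_eq singletonD)
  qed (auto simp: period_def)
  finally show ?thesis .
qed

section \<open>Automorphisms preserving or inverting the rotation\<close>

lemma embedding_automorphism_affine:
  assumes g: "g \<in> E"
  shows "embedding_automorphism complete_graph R (\<lambda>x. g * x + b)"
proof -
  have "bij (\<lambda>x. g * x + b)"
    by (rule bij_betwI[of _ _ _ "\<lambda>y. (y - b) / g"]) (use E_nonzero[OF g] in auto)
  \<comment> \<open>Translation leaves differences unchanged and \<open>r\<close> commutes with
    \<open>g\<close>, so the map commutes with the rotation.\<close>
  moreover have "g * x + b + r (g * y - g * x) = g * (x + r (y - x)) + b" for x y
    using r_mult[OF g, of "y - x"] by (simp add: algebra_simps)
  ultimately show ?thesis using E_nonzero[OF g]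
    by (auto simp: embedding_automorphism_def graph_automorphism_def complete_graph_def
        archdeacon_rotation_def)
qed

text \<open>Preservation of face lengths puts \<open>c\<close> in \<open>E\<close>. Two rotation
  steps at 0 lead from \<open>\<gamma> ^ k\<close> through \<open>- (\<xi> * \<gamma> ^ k)\<close>
  to \<open>\<gamma> ^ Suc k\<close>, so \<sigma> is determined by its values at 0 and 1.\<close>

lemma preserving_imp_affine:
  assumes bij: "bij \<sigma>"
    and com: "\<And>x y. x \<noteq> y \<Longrightarrow> \<sigma> (x + r (y - x)) = \<sigma> x + r (\<sigma> y - \<sigma> x)"
  shows "\<exists>g\<in>E. \<exists>b. \<sigma> = (\<lambda>x. g * x + b)"
proof -
  let ?h = "map_prod \<sigma> \<sigma>" and ?f = "face_map R"
  define c where "c = \<sigma> 1 - \<sigma> 0"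
  have inj: "\<sigma> x = \<sigma> y \<longleftrightarrow> x = y" for x y using bij by (auto simp: bij_def inj_eq)
  have "(?f ^^ k) (?h (x, y)) = ?h ((?f ^^ k) (x, y))" if "x \<noteq> y" for k x y
    using that
  proof (induction k arbitrary: x y)
    case (Suc k)
    then have "y + r (x - y) \<noteq> y" using r_nonzero by simp
    then show ?case using Suc.IH[of y "y + r (x - y)"] com[of y x] Suc.prems
      by (simp add: funpow_Suc_right face_map_def archdeacon_rotation_def del: funpow.simps)
  qed simp
  from this[of 0 1 m] have "(?f ^^ m) (\<sigma> 0, \<sigma> 1) = (\<sigma> 0, \<sigma> 1)"
    using face_map_funpow_eq_iff[of 0 1 m] E_gen by (simp add: period_def)
  then have c: "c \<in> E" unfolding c_def by (intro face_map_m_fixed_imp_E) (simp_all add: inj)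
  have rot: "\<sigma> (r y) - \<sigma> 0 = r (\<sigma> y - \<sigma> 0)" if "y \<noteq> 0" for y
    using com[of 0 y] that by simp
  have step: "\<sigma> (- (\<xi> * a)) - \<sigma> 0 = - (\<xi> * (c * a))" if "a \<in> E" "\<sigma> a - \<sigma> 0 = c * a" for a
    using rot[of a] that c by (simp add: r_pos E_mult E_nonzero)
  have "\<sigma> (\<gamma> ^ k) - \<sigma> 0 = c * \<gamma> ^ k" for k
  proof (induction k)
    case (Suc k)
    have k: "\<gamma> ^ k \<in> E" by (intro E_power E_mult E_gen)
    have "r (- (\<xi> * \<gamma> ^ k)) = \<gamma> ^ Suc k" using k by (simp add: r_uminus_E E_mult E_gen)
    moreover have "r (- (\<xi> * (c * \<gamma> ^ k))) = c * \<gamma> ^ Suc k"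
      using k c by (simp add: r_uminus_E E_mult E_gen)
    ultimately show ?case using rot[of "- (\<xi> * \<gamma> ^ k)"] step[OF k Suc] by simp
  qed (simp add: c_def)
  then have pos: "\<sigma> a - \<sigma> 0 = c * a" if "a \<in> E" for a using that by (auto elim: E_cases)
  have "\<sigma> a = c * a + \<sigma> 0" for a
  proof -
    consider "a = 0" | "a \<in> E" | "- a \<in> E" using E_total by blast
    then show ?thesis
    proof cases
      case 3
      \<comment> \<open>A negated entry \<open>a\<close> is one rotation step away from the entry
        \<open>- a / \<xi>\<close>.\<close>
      then have "- a / \<xi> \<in> E" by (intro E_divide E_gen)
      from step[OF this pos[OF this]] show ?thesis by (simp add: algebra_simps)
    qed (use pos[of a] in \<open>simp_all add: algebra_simps\<close>)
  qed
  then show ?thesis using c by blast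
qed

text \<open>The rotation at \<open>0\<close> forces a reversing automorphism to be \<open>x \<mapsto> c / x\<close> up to translation;
  the rotations at \<open>1\<close> and \<open>- 1\<close> then make both \<open>\<epsilon>\<close> and \<open>\<xi>\<close> primitive cube roots of unity.\<close>

lemma not_reversing:
  assumes bij: "bij \<sigma>"
    and rev: "\<And>x y. x \<noteq> y \<Longrightarrow> \<sigma> x + r (\<sigma> (x + r (y - x)) - \<sigma> x) = \<sigma> y"
  shows False
proof -
  \<comment> \<open>Inverting the rotation makes image faces run backwards, so \<sigma> is combined
    with reversal of the edge.\<close>
  let ?h = "\<lambda>(x, y). (\<sigma> y, \<sigma> x)" and ?f = "face_map R"
  define s where "s x = \<sigma> x - \<sigma> 0" for x
  define c where "c = s 1"
  have inj: "\<sigma> x = \<sigma> y \<longleftrightarrow> x = y" for x y using bij by (auto simp: bij_def inj_eq)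
  have s0: "s 0 = 0" by (simp add: s_def)
  have com: "s x + r (s (x + r (y - x)) - s x) = s y" if "x \<noteq> y" for x y
    using rev[OF that] by (simp add: s_def algebra_simps)
  have "(?f ^^ k) (?h ((?f ^^ k) (x, y))) = ?h (x, y)" if "x \<noteq> y" for k x y
    using that
  proof (induction k arbitrary: x y)
    case (Suc k)
    then have ne: "y + r (x - y) \<noteq> y" using r_nonzero by simp
    have "(?f ^^ Suc k) (?h ((?f ^^ Suc k) (x, y)))
        = ?f ((?f ^^ k) (?h ((?f ^^ k) (?f (x, y)))))"
      unfolding funpow_Suc_right[of k ?f, THEN fun_cong, unfolded o_apply, of "(x, y)"] by simp
    also have "\<dots> = ?f (?h (?f (x, y)))"
      using Suc.IH[of y "y + r (x - y)"] ne by (simp add: face_map_def archdeacon_rotation_def)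
    also have "\<dots> = ?h (x, y)"
      using rev[of y x] Suc.prems by (simp add: face_map_def archdeacon_rotation_def)
    finally show ?case .
  qed simp
  \<comment> \<open>The edge from 0 to 1 lies on a face of length \<open>m\<close>; hence so does
    its reversed image, which puts \<open>- c\<close> rather than \<open>c\<close> in
    \<open>E\<close>.\<close>
  from this[of 0 1 m] have "(?f ^^ m) (\<sigma> 1, \<sigma> 0) = (\<sigma> 1, \<sigma> 0)"
    using face_map_funpow_eq_iff[of 0 1 m] E_gen by (simp add: period_def)
  then have "\<sigma> 0 - \<sigma> 1 \<in> E" by (intro face_map_m_fixed_imp_E) (simp_all add: inj)
  then have c: "- c \<in> E" by (simp add: c_def s_def)
  then have c0: "c \<noteq> 0" using zero_notin_E by auto
  have rot: "r (s (r y)) = s y" if "y \<noteq> 0" for y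
    using com[of 0 y] that by (simp add: s0)
  \<comment> \<open>Here \<open>r\<close> has to be undone: its inverse on negated entries divides
    by \<open>- \<xi>\<close>, so the factor lands in the denominator.\<close>
  have step: "s (- (\<xi> * a)) = - (c / (\<xi> * a))" if "a \<in> E" "s a = c / a" for a
  proof -
    have "- (c / a) \<in> E" using E_divide[OF c that(1)] by simp
    then show ?thesis using rot[of a] that by (simp add: r_pos E_nonzero r_inverse_neg mult.commute)
  qed
  have "s (\<gamma> ^ k) = c / \<gamma> ^ k" for k
  proof (induction k)
    case (Suc k)
    have k: "\<gamma> ^ k \<in> E" by (intro E_power E_mult E_gen)
    then have "- (c / (\<xi> * \<gamma> ^ k)) \<in> E"
      using E_divide[OF c E_mult[OF E_gen(3) k]] by simp
    moreover have "r (- (\<xi> * \<gamma> ^ k)) = \<gamma> ^ Suc k" using k by (simp add: r_uminus_E E_mult E_gen)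
    ultimately show ?case using rot[of "- (\<xi> * \<gamma> ^ k)"] step[OF k Suc]
      by (simp add: r_inverse_pos mult_ac)
  qed (simp add: c_def)
  then have pos: "s a = c / a" if "a \<in> E" for a using that by (auto elim: E_cases)
  \<comment> \<open>At \<open>a = 0\<close> the formula agrees with \<open>s 0 = 0\<close> through
    the convention \<open>c / 0 = 0\<close>.\<close>
  have s: "s a = c / a" for a
  proof -
    consider "a = 0" | "a \<in> E" | "- a \<in> E" using E_total by blast
    then show ?thesis
    proof cases
      case 3
      then have "- a / \<xi> \<in> E" by (intro E_divide E_gen)
      from step[OF this pos[OF this]] show ?thesis by simp
    qed (use pos[of a] s0 in simp_all)
  qed
  have ne: "1 + \<epsilon> \<noteq> 0" "1 + \<xi> \<noteq> 0"
    using E_minus[OF E_gen(1)] E_gen by (metis add_eq_0_iff)+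
  \<comment> \<open>Clearing denominators turns the relation into \<open>x ^ 2 + x + 1 = 0\<close>,
    a factor of \<open>x ^ 3 - 1\<close>.\<close>
  have cube: "x ^ 3 = 1" if "c / (1 + x) - c = c / x" "1 + x \<noteq> 0" "x \<noteq> 0" for x
  proof -
    have "(c - c * (1 + x)) * x = c * (1 + x)" using that by (simp add: divide_simps)
    moreover have "c * (x ^ 2 + x + 1) = c * (1 + x) - (c - c * (1 + x)) * x"
      by (simp add: algebra_simps power2_eq_square)
    ultimately have "x ^ 2 + x + 1 = 0" using c0 by simp
    moreover have "x ^ 3 - 1 = (x ^ 2 + x + 1) * (x - 1)"
      by (simp add: algebra_simps power2_eq_square power3_eq_cube)
    ultimately show ?thesis by simp
  qed
  \<comment> \<open>The rotation at 1 takes the edge towards 0 to the edge towards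
    \<open>1 + \<epsilon>\<close>.\<close>
  have "r (c / (1 + \<epsilon>) - c) = - c"
    using com[of 1 0] r_uminus_E[OF E_gen(1)] by (simp add: s add_eq_0_iff)
  then have "c / (1 + \<epsilon>) - c = c / \<epsilon>" using r_inverse_pos[OF c] by simp
  then have m: "m dvd 3"
    using cube ne by (simp flip: has_mult_order_power_eq_1_iff[OF \<epsilon>])
  \<comment> \<open>Likewise, the rotation at \<open>- 1\<close> takes the edge towards 0 to the
    edge towards \<open>- 1 - \<xi>\<close>.\<close>
  have "s (- 1 - \<xi>) = - (c / (1 + \<xi>))"
    unfolding s by (metis minus_add_distrib minus_divide_right uminus_add_conv_diff add.commute)
  then have "- c + r (c - c / (1 + \<xi>)) = 0"
    using com[of "- 1" 0] r_pos[OF E_gen(1)] by (simp add: s)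
  then have "r (c - c / (1 + \<xi>)) = c" by (simp add: add_eq_0_iff)
  then have "c - c / (1 + \<xi>) = - (c / \<xi>)" using r_inverse_neg[OF c] by simp
  then have "c / (1 + \<xi>) - c = c / \<xi>" by (metis minus_diff_eq minus_minus)
  then have n: "n dvd 3"
    using cube ne by (simp flip: has_mult_order_power_eq_1_iff[OF \<xi>])
  have "prime (3::nat)" by simp
  then have "m = 3" "n = 3" using m n gt1 by (auto simp: prime_nat_iff)
  then show False using coprime by simp
qed

section \<open>The full automorphism group and the stabiliser of 0\<close>

lemma carrier_Aut:
  "carrier (Aut_embedding complete_graph R) = (\<lambda>(g, b). \<lambda>x. g * x + b) ` (E \<times> UNIV)"
proof (intro equalityI subsetI)
  fix \<sigma> assume "\<sigma> \<in> carrier (Aut_embedding complete_graph R)"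
  then have "embedding_automorphism complete_graph R \<sigma>" by (simp add: Aut_embedding_def)
  then have bij: "bij \<sigma>"
    and or: "(\<forall>e\<in>complete_graph. map_prod \<sigma> \<sigma> (R e) = R (map_prod \<sigma> \<sigma> e)) \<or>
      (\<forall>e\<in>complete_graph. map_prod \<sigma> \<sigma> (R e) = inv_into complete_graph R (map_prod \<sigma> \<sigma> e))"
    by (auto simp: embedding_automorphism_def graph_automorphism_def)
  from or have "\<exists>g\<in>E. \<exists>b. \<sigma> = (\<lambda>x. g * x + b)"
  proof
    assume *: "\<forall>e\<in>complete_graph. map_prod \<sigma> \<sigma> (R e) = R (map_prod \<sigma> \<sigma> e)"
    show ?thesis
    proof (rule preserving_imp_affine[OF bij])
      fix x y :: 'a assume "x \<noteq> y"
      then show "\<sigma> (x + r (y - x)) = \<sigma> x + r (\<sigma> y - \<sigma> x)"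
        using *[rule_format, of "(x, y)"] by (simp add: complete_graph_def archdeacon_rotation_def)
    qed
  next
    assume *: "\<forall>e\<in>complete_graph. map_prod \<sigma> \<sigma> (R e)
      = inv_into complete_graph R (map_prod \<sigma> \<sigma> e)"
    have "False"
    proof (rule not_reversing[OF bij])
      fix x y :: 'a assume xy: "x \<noteq> y"
      then have "(\<sigma> x, \<sigma> y) \<in> R ` complete_graph"
        using bij by (intro R_surj) (auto simp: bij_def inj_eq)
      then have "R (map_prod \<sigma> \<sigma> (R (x, y))) = (\<sigma> x, \<sigma> y)"
        using *[rule_format, of "(x, y)"] xy by (simp add: complete_graph_def f_inv_into_f)
      then show "\<sigma> x + r (\<sigma> (x + r (y - x)) - \<sigma> x) = \<sigma> y"
        by (simp add: archdeacon_rotation_def)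
    qed
    then show ?thesis ..
  qed
  then show "\<sigma> \<in> (\<lambda>(g, b). \<lambda>x. g * x + b) ` (E \<times> UNIV)" by auto
qed (auto simp: Aut_embedding_def embedding_automorphism_affine)

text \<open>The values at 0 and 1 recover \<open>b\<close> and \<open>g\<close>, so the order is
  \<open>m * n * (2 * m * n + 1)\<close>, which is the binomial coefficient.\<close>

lemma order_Aut: "order (Aut_embedding complete_graph R) = (2 * m * n + 1) choose 2"
proof -
  have "inj_on (\<lambda>(g, b). \<lambda>x. g * x + b) (E \<times> (UNIV :: 'a set))"
  proof (rule inj_onI, clarify)
    fix g b g' b' :: 'a assume eq: "(\<lambda>x. g * x + b) = (\<lambda>x. g' * x + b')"
    show "g = g' \<and> b = b'" using fun_cong[OF eq, of 0] fun_cong[OF eq, of 1] by simp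
  qed
  then have "order (Aut_embedding complete_graph R) = (m * n) * (2 * m * n + 1)"
    by (simp add: order_def carrier_Aut card_image card_cartesian_product card_E card_field)
  then show ?thesis by (simp add: choose_two)
qed

lemma carrier_Aut0:
  "carrier (Aut0_embedding complete_graph R) = range (\<lambda>k. (*) (\<gamma> ^ k))"
proof (intro equalityI subsetI)
  fix \<sigma> :: "'a \<Rightarrow> 'a" assume "\<sigma> \<in> range (\<lambda>k. (*) (\<gamma> ^ k))"
  then obtain k where "\<sigma> = (\<lambda>x. \<gamma> ^ k * x + 0)" by auto
  moreover have "\<gamma> ^ k \<in> E" by (intro E_power E_mult E_gen)
  ultimately have "\<sigma> \<in> carrier (Aut_embedding complete_graph R)" "\<sigma> 0 = 0"
    unfolding carrier_Aut by (auto intro: image_eqI[of _ _ "(\<gamma> ^ k, 0)"])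
  then show "\<sigma> \<in> carrier (Aut0_embedding complete_graph R)"
    by (simp add: Aut0_embedding_def)
qed (auto simp: Aut0_embedding_def carrier_Aut E_eq_powers)

text \<open>The exponent \<open>k\<close> corresponds to multiplication by
  \<open>\<gamma> ^ k\<close>. The isomorphism starts from the cyclic group, so that inverting it by
  \<open>iso_sym\<close> uses the group laws on that side only.\<close>

lemma Aut0_iso: "Aut0_embedding complete_graph R \<cong> integer_mod_group (m * n)"
proof -
  let ?h = "\<lambda>k. (*) (\<gamma> ^ nat k)"
  have mn: "0 < m * n" using gt1 by simp
  have eq: "(*) (\<gamma> ^ k) = (*) (\<gamma> ^ l) \<longleftrightarrow> [k = l] (mod (m * n))" for k l
  proof
    assume "(*) (\<gamma> ^ k) = (*) (\<gamma> ^ l)"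
    from fun_cong[OF this, of 1] show "[k = l] (mod (m * n))"
      by (simp add: has_mult_order_eq_iff[OF \<gamma>])
  qed (simp add: has_mult_order_eq_iff[OF \<gamma>, symmetric])
  have "?h \<in> iso (integer_mod_group (m * n)) (Aut0_embedding complete_graph R)"
    unfolding iso_def
  proof (intro CollectI conjI homI)
    show "?h (x \<otimes>\<^bsub>integer_mod_group (m * n)\<^esub> y)
        = ?h x \<otimes>\<^bsub>Aut0_embedding complete_graph R\<^esub> ?h y"
      if "x \<in> carrier (integer_mod_group (m * n))" "y \<in> carrier (integer_mod_group (m * n))" for x y
    proof -
      have xy: "0 \<le> x" "0 \<le> y" using that mn by (auto simp: carrier_integer_mod_group split: if_splits)
      have "?h (x \<otimes>\<^bsub>integer_mod_group (m * n)\<^esub> y) = (*) (\<gamma> ^ (nat x + nat y))"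
        using xy by (simp only: eq) 
          (simp add: mult_integer_mod_group cong_def nat_mod_distrib nat_add_distrib nat_mult_distrib)
      also have "\<dots> = ?h x \<circ> ?h y" by (simp add: power_add fun_eq_iff mult.assoc)
      finally show ?thesis by (simp add: Aut0_embedding_def Aut_embedding_def)
    qed
    show "bij_betw ?h (carrier (integer_mod_group (m * n))) (carrier (Aut0_embedding complete_graph R))"
      unfolding bij_betw_def
    proof
      show "inj_on ?h (carrier (integer_mod_group (m * n)))"
      proof (rule inj_onI)
        fix x y assume "x \<in> carrier (integer_mod_group (m * n))"
          "y \<in> carrier (integer_mod_group (m * n))" "?h x = ?h y"
        moreover have "nat z < m * n" if "0 \<le> z" "z < int (m * n)" for z
          using that mn by linarith
        ultimately have "0 \<le> x" "0 \<le> y" "nat x = nat y"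
          using mn unfolding eq
          by (auto simp: carrier_integer_mod_group split: if_splits
              intro: cong_less_modulus_unique_nat)
        then show "x = y" by simp
      qed
      show "?h ` carrier (integer_mod_group (m * n)) = carrier (Aut0_embedding complete_graph R)"
      proof (intro equalityI subsetI)
        fix \<sigma> assume "\<sigma> \<in> carrier (Aut0_embedding complete_graph R)"
        then obtain k where "\<sigma> = (*) (\<gamma> ^ k)" unfolding carrier_Aut0 by blast
        then have "\<sigma> = ?h (int (k mod (m * n)))" by (simp only: nat_int eq) (simp add: cong_def)
        moreover have "int (k mod (m * n)) \<in> carrier (integer_mod_group (m * n))"
          using mn by (simp add: carrier_integer_mod_group zmod_int)
        ultimately show "\<sigma> \<in> ?h ` carrier (integer_mod_group (m * n))" by blast
      qed (auto simp: carrier_Aut0)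
    qed
  qed (auto simp: carrier_Aut0)
  then show ?thesis
    using group.iso_sym[OF group_integer_mod_group] unfolding is_iso_def by blast
qed

end

section \<open>From the Heffter condition to the theorem\<close>

lemma heffter_power_array_gt_1:
  fixes \<epsilon> \<xi> :: "'a::field"
  assumes "heffter_array m n (power_array \<epsilon> \<xi>)" "0 < m" "0 < n"
  shows "1 < m" "1 < n"
proof -
  have "(\<Sum>j=1..n. power_array \<epsilon> \<xi> 1 j) = 0" "(\<Sum>i=1..m. power_array \<epsilon> \<xi> i 1) = 0"
    using assms by (auto simp: heffter_array_def)
  \<comment> \<open>A first row or column with a single entry would have sum
    \<open>1\<close>.\<close>
  then have "n \<noteq> 1" "m \<noteq> 1" by (auto simp: power_array_def)
  then show "1 < m" "1 < n" using assms by auto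
qed

theorem theorem3p8:
  fixes q m n :: nat and \<xi> \<epsilon> :: "'a::{field,finite}"
  defines "A \<equiv> power_array \<epsilon> \<xi>"
    and "K \<equiv> (complete_graph :: ('a \<times> 'a) set)"
  defines "\<rho> \<equiv> archdeacon_rotation m n A"
  assumes "q = 2 * m * n + 1" and "primepow q" and "CARD('a) = q"
    and "0 < m" and "0 < n" and "odd m" and "odd n" and "coprime m n"
    and "has_mult_order \<xi> n" and "has_mult_order \<epsilon> m"
    and "heffter_array m n A" and "compatible_orderings m n A"
  shows "Aut0_embedding K \<rho> \<cong> integer_mod_group (m * n)
    \<and> order (Aut_embedding K \<rho>) = (2 * m * n + 1) choose 2
    \<and> (\<forall>w\<in>face_walks K \<rho>. simple_cycle K w)
    \<and> length ` face_walks K \<rho> = {m, n}"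
proof -
  have "1 < m" "1 < n"
    using heffter_power_array_gt_1 assms(14,7,8) unfolding A_def by blast+
  then interpret power_embedding m n \<epsilon> \<xi>
    using assms by unfold_locales simp_all
  have "\<forall>w\<in>face_walks K \<rho>. simple_cycle K w"
    unfolding face_walks_def K_def \<rho>_def A_def
    using simple_cycle_face_walk by (auto simp: complete_graph_def[where 'a='a])
  then show ?thesis
    using Aut0_iso order_Aut length_face_walks unfolding K_def \<rho>_def A_def by blast
qed

end
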